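(* For $B\geq 2$, $z\in \mathbb C$ and $|q|<1$, $$\prod_{i=0}^{\infty}\frac{1-z^Bq^{B^{i+1}}}{1-zq^{B^i}}\ =\ \frac{1}{1-zq} \ +\ \frac{z-z^B}{1-z^Bq}\sum_{n=1}^{\infty}q^{B^{n}}\frac{\prod_{j=0}^{n-1} (1-z^Bq^{B^{j}})}{\prod_{j=0}^{n}(1-zq^{B^j})}.$$ *)

theory Defs
  imports "HOL-Analysis.Analysis"
begin

end

theory Submission
  imports Defs
begin

text \<open>
  Put \<open>a\<^sub>j = 1 - z^B q^(B^j)\<close>, \<open>b\<^sub>j = 1 - z q^(B^j)\<close> and
  \<open>Q\<^sub>n = a\<^sub>1 \<cdots> a\<^sub>n / (b\<^sub>0 \<cdots> b\<^sub>n)\<close>. Since \<open>a\<^sub>n - b\<^sub>n = (z - z^B) q^(B^n)\<close>, the difference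
  \<open>Q\<^sub>n\<^sub>+\<^sub>1 - Q\<^sub>n\<close> is the \<open>n\<close>-th term of the series times \<open>(z - z^B) / a\<^sub>0\<close>, so the right-hand side
  telescopes to \<open>lim Q\<^sub>n\<close>. As \<open>b\<^sub>n \<longlonglongrightarrow> 1\<close>, this limit is the infinite product.
\<close>

text \<open>A convergent sequence is bounded, so comparison applies. This yields absolute
  summability both of the deviations of the product's factors from 1 and of the series.\<close>

lemma summable_norm_mult_convergent:
  fixes x y :: "nat \<Rightarrow> 'a::real_normed_field"
  assumes "summable (\<lambda>n. norm (x n))" and "convergent y"
  shows "summable (\<lambda>n. norm (x n * y n))"
proof -
  obtain K where K: "\<And>n. norm (y n) \<le> K"
    using convergent_imp_Bseq[OF assms(2)] unfolding Bseq_def by blast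
  show ?thesis
  proof (rule summable_comparison_test')
    show "summable (\<lambda>n. norm (x n) * K)"
      using assms(1) by (rule summable_mult2)
    show "norm (norm (x n * y n)) \<le> norm (x n) * K" if "n \<ge> 0" for n
      by (simp add: norm_mult mult_left_mono K)
  qed
qed

text \<open>Comparison with the geometric series, since \<open>n < 2 ^ n\<close> and
  \<open>2 ^ n \<le> B ^ n\<close>.\<close>

lemma summable_norm_power_power:
  fixes q :: "'a::real_normed_field"
  assumes "B \<ge> 2" and "norm q < 1"
  shows "summable (\<lambda>n. norm (q ^ (B ^ n)))"
proof (rule summable_comparison_test')
  show "summable (\<lambda>n. norm q ^ n)"
    using assms(2) by (simp add: summable_geometric)
  show "norm (norm (q ^ (B ^ n))) \<le> norm q ^ n" if "n \<ge> 0" for n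
  proof -
    have "n \<le> B ^ n"
      using assms(1) less_exp[of n] power_mono[of 2 B n] by linarith
    then show ?thesis
      using assms(2) by (simp add: norm_power power_decreasing)
  qed
qed

text \<open>Passing from \<open>n\<close> to \<open>Suc n\<close> multiplies the left side by
  \<open>a (Suc n) / b (Suc n)\<close>, that is, by 1 plus
  \<open>(a (Suc n) - b (Suc n)) / b (Suc n)\<close>.\<close>

lemma prod_quotient_telescope:
  fixes a b :: "nat \<Rightarrow> 'a::field"
  assumes "\<And>n. b n \<noteq> 0"
  shows "(\<Prod>i<n. a (Suc i) / b i) / b n
    = 1 / b 0 + (\<Sum>k<n. (\<Prod>i<k. a (Suc i) / b i) / b k * (a (Suc k) - b (Suc k)) / b (Suc k))"
proof (induction n)
  case (Suc n)
  have "(\<Prod>i<Suc n. a (Suc i) / b i) / b (Suc n) = (\<Prod>i<n. a (Suc i) / b i) / b n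
      + (\<Prod>i<n. a (Suc i) / b i) / b n * (a (Suc n) - b (Suc n)) / b (Suc n)"
    using assms[of n] assms[of "Suc n"] by (simp add: field_simps)
  then show ?case
    unfolding Suc.IH[symmetric] sum.lessThan_Suc add.assoc[symmetric] .
qed simp

text \<open>The numerators of the series start at \<open>a 0\<close>, those of the partial products
  at \<open>a 1\<close>. Splitting off \<open>a 0\<close> matches the two; it later cancels the
  prefactor \<open>1 / a 0\<close>.\<close>

lemma prod_quotient_shift:
  fixes a b :: "nat \<Rightarrow> 'a::field"
  shows "(\<Prod>j=0..n. a j) / (\<Prod>j=0..Suc n. b j)
    = a 0 * ((\<Prod>i<n. a (Suc i) / b i) / b n / b (Suc n))"
proof -
  have "(\<Prod>j=0..n. a j) = a 0 * (\<Prod>i<n. a (Suc i))"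
    by (induction n) (simp_all add: mult_ac)
  moreover have "(\<Prod>j=0..Suc n. b j) = (\<Prod>i<n. b i) * b n * b (Suc n)"
    by (simp add: atLeast0AtMost lessThan_Suc_atMost[symmetric])
  ultimately show ?thesis
    by (simp add: prod_dividef)
qed

theorem theorem2p4:
  fixes B :: nat and z q :: complex
  assumes "B \<ge> 2"
    and "norm q < 1"
    and "\<And>i. 1 - z * q ^ (B ^ i) \<noteq> 0"
    and "1 - z ^ B * q \<noteq> 0"
  shows "convergent_prod (\<lambda>i. (1 - z ^ B * q ^ (B ^ (i + 1))) / (1 - z * q ^ (B ^ i)))
    \<and> summable (\<lambda>n. q ^ (B ^ (n + 1)) *
          ((\<Prod>j=0..n. 1 - z ^ B * q ^ (B ^ j)) / (\<Prod>j=0..n + 1. 1 - z * q ^ (B ^ j))))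
    \<and> (\<Prod>i. (1 - z ^ B * q ^ (B ^ (i + 1))) / (1 - z * q ^ (B ^ i)))
        = 1 / (1 - z * q) + (z - z ^ B) / (1 - z ^ B * q) *
          (\<Sum>n. q ^ (B ^ (n + 1)) *
            ((\<Prod>j=0..n. 1 - z ^ B * q ^ (B ^ j)) / (\<Prod>j=0..n + 1. 1 - z * q ^ (B ^ j))))"
proof -
  define x where "x = (\<lambda>j. q ^ (B ^ j))"
  define a where "a = (\<lambda>j. 1 - z ^ B * x j)"
  define b where "b = (\<lambda>j. 1 - z * x j)"
  define f where "f = (\<lambda>i. a (Suc i) / b i)"
  define Q where "Q = (\<lambda>n. (\<Prod>i<n. f i) / b n)"
  define T where "T = (\<lambda>n. x (Suc n) * ((\<Prod>j=0..n. a j) / (\<Prod>j=0..Suc n. b j)))"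
  have b_nz: "b n \<noteq> 0" for n
    using assms(3) by (simp add: b_def x_def)
  have a0: "a 0 = 1 - z ^ B * q" and b0: "b 0 = 1 - z * q"
    by (simp_all add: a_def b_def x_def)
  have a0_nz: "a 0 \<noteq> 0"
    using assms(4) a0 by simp

  have sum_x: "summable (\<lambda>n. norm (x n))"
    unfolding x_def using assms(1,2) by (rule summable_norm_power_power)
  then have sum_x_Suc: "summable (\<lambda>n. norm (x (Suc n)))"
    by (subst summable_Suc_iff)
  have "x \<longlonglongrightarrow> 0"
    using sum_x summable_LIMSEQ_zero tendsto_norm_zero_iff by blast
  then have b_lim: "b \<longlonglongrightarrow> 1"
    unfolding b_def by (auto intro!: tendsto_eq_intros)
  then have inv_b_lim: "(\<lambda>n. 1 / b n) \<longlonglongrightarrow> 1"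
    by (auto intro!: tendsto_eq_intros)

  \<comment> \<open>The constants cancel in \<open>a (Suc n) - b n\<close>, leaving a summable
    numerator times a convergent factor.\<close>
  have "f n - 1 = (z * x n - z ^ B * x (Suc n)) * (1 / b n)" for n
    using b_nz[of n] by (simp add: f_def a_def b_def field_simps)
  moreover have "summable (\<lambda>n. norm ((z * x n - z ^ B * x (Suc n)) * (1 / b n)))"
  proof (rule summable_norm_mult_convergent)
    show "summable (\<lambda>n. norm (z * x n - z ^ B * x (Suc n)))"
    proof (rule summable_comparison_test')
      show "summable (\<lambda>n. norm z * norm (x n) + norm (z ^ B) * norm (x (Suc n)))"
        by (intro summable_add summable_mult sum_x sum_x_Suc)
      show "norm (norm (z * x n - z ^ B * x (Suc n)))
          \<le> norm z * norm (x n) + norm (z ^ B) * norm (x (Suc n))" if "n \<ge> 0" for n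
        using norm_triangle_ineq4[of "z * x n" "z ^ B * x (Suc n)"] by (simp add: norm_mult)
    qed
    show "convergent (\<lambda>n. 1 / b n)"
      using inv_b_lim by (rule convergentI)
  qed
  \<comment> \<open>Some \<open>a (Suc i)\<close> may vanish; \<open>convergent_prod\<close> allows
    finitely many zero factors.\<close>
  ultimately have conv: "convergent_prod f"
    by (intro abs_convergent_prod_imp_convergent_prod)
       (simp add: abs_convergent_prod_conv_summable)
  then have "(\<lambda>n. \<Prod>i\<le>n. f i) \<longlonglongrightarrow> prodinf f"
    by (rule convergent_prod_LIMSEQ)
  then have "(\<lambda>n. \<Prod>i<n. f i) \<longlonglongrightarrow> prodinf f"
    by (subst filterlim_sequentially_Suc[symmetric]) (simp add: lessThan_Suc_atMost)
  then have Q_lim: "Q \<longlonglongrightarrow> prodinf f"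
    unfolding Q_def using b_lim by (auto intro!: tendsto_eq_intros)

  \<comment> \<open>Here \<open>x (Suc n)\<close> is absolutely summable and the factor after it
    converges, because \<open>Q\<close> and \<open>1 / b\<close> do.\<close>
  have T_eq: "T n = a 0 * (x (Suc n) * (Q n * (1 / b (Suc n))))" for n
    unfolding T_def Q_def f_def prod_quotient_shift by simp
  have "convergent (\<lambda>n. Q n * (1 / b (Suc n)))"
    using tendsto_mult[OF Q_lim LIMSEQ_Suc[OF inv_b_lim]] by (rule convergentI)
  then have "summable (\<lambda>n. norm (x (Suc n) * (Q n * (1 / b (Suc n)))))"
    by (rule summable_norm_mult_convergent[OF sum_x_Suc])
  then have "summable (\<lambda>n. x (Suc n) * (Q n * (1 / b (Suc n))))"
    by (rule summable_norm_cancel)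
  then have sum_T: "summable T"
    unfolding T_eq by (rule summable_mult)

  have "Q k * (a (Suc k) - b (Suc k)) / b (Suc k) = (z - z ^ B) / a 0 * T k" for k
  proof -
    have diff: "a (Suc k) - b (Suc k) = (z - z ^ B) * x (Suc k)"
      by (simp add: a_def b_def algebra_simps)
    show ?thesis
      unfolding diff T_eq using a0_nz by simp
  qed
  then have "Q n = 1 / b 0 + (z - z ^ B) / a 0 * (\<Sum>k<n. T k)" for n
    using prod_quotient_telescope[of b a n, OF b_nz]
    by (simp add: Q_def f_def sum_distrib_left)
  moreover have "(\<lambda>n. 1 / b 0 + (z - z ^ B) / a 0 * (\<Sum>k<n. T k))
      \<longlonglongrightarrow> 1 / b 0 + (z - z ^ B) / a 0 * suminf T"
    by (intro tendsto_intros summable_LIMSEQ sum_T)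
  \<comment> \<open>Both sides are limits of the same sequence \<open>Q\<close>.\<close>
  ultimately have "prodinf f = 1 / b 0 + (z - z ^ B) / a 0 * suminf T"
    using Q_lim LIMSEQ_unique by (metis (no_types, lifting) ext)
  then show ?thesis
    using conv sum_T unfolding a0 b0
    by (simp only: f_def T_def a_def b_def x_def Suc_eq_plus1)
qed

end
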